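(* Fix $\alpha \in \mathbb{C}$ and an integer $x \geq 1$. Then $$\sigma_{\alpha}(x) = H_x^{(1-\alpha)} + \widehat{S}_0^{(\alpha)}(x) + \widehat{S}_1^{(\alpha)}(x) + \widehat{S}_2^{(\alpha)}(x),$$ where for $i = 0,1,2$, $$\widehat{S}_i^{(\alpha)}(x) := [q^x] \sum_{n=1}^x \widetilde{S}_{i,n}(q)\, n^{\alpha-1}.$$
   Context: $\sigma_\alpha(x) = \sum_{d \mid x} d^{\alpha}$ and $H_n^{(r)} = \sum_{k=1}^n k^{-r}$. $[q^x]F(q)$ denotes the coefficient of $q^x$ in the power series expansion of the rational function $F$ about $q=0$. $\Phi_n(q) = \prod_{1\le k\le n,\ \gcd(k,n)=1}(q - e^{2\pi i k/n})$ is the $n$-th cyclotomic polynomial, and $\widetilde{\Phi}_n(q) := \frac{1}{q}\cdot \frac{d}{dw}\left[\log \Phi_n(w)\right]\big|_{w = 1/q}$. For $n \geq 2$, $\Pi_n(q) := \sum_{j=0}^{n-2} \frac{(n-1-j) q^j (1-q)}{1-q^n}$. For a prime $p$, $\nu_p(n)$ is the exponent of $p$ in $n$. Sums indexed by $p$ run over primes. For $n \ge 1$: $\widetilde{S}_{0,n}(q) = \sum_{d \mid n,\ d>1,\ d \neq p^k, 2p^k} \widetilde{\Phi}_d(q)$ (the sum over divisors $d>1$ of $n$ not of the form $p^k$ or $2p^k$ for a prime $p$ and $k \ge 1$); $\widetilde{S}_{1,n}(q) = \sum_{p \mid n} \Pi_{p^{\nu_p(n)}}(q)$; $\widetilde{S}_{2,n}(q)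 = \sum_{2p \mid n,\ p > 2} \Pi_{p^{\nu_p(n)}}(-q)$. *)

theory Defs
  imports
    "HOL-Complex_Analysis.Complex_Analysis"
    "HOL-Computational_Algebra.Computational_Algebra"
begin

definition divisor_sigma :: "complex \<Rightarrow> nat \<Rightarrow> complex" where
  "divisor_sigma \<alpha> x = (\<Sum>d | d dvd x. of_nat d powr \<alpha>)"

definition gen_harmonic :: "complex \<Rightarrow> nat \<Rightarrow> complex" where
  "gen_harmonic r n = (\<Sum>k=1..n. of_nat k powr (- r))"

section \<open>Rational functions and their expansion about 0\<close>

type_synonym ratfun = "complex poly fract"

definition ratfun_const :: "complex \<Rightarrow> ratfun" where
  "ratfun_const c = to_fract [:c:]"

definition ratfun_q :: ratfun where
  "ratfun_q = to_fract [:0, 1:]"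

text \<open>
  The expansion about 0 is taken in formal Laurent series, so that it is total: it is the
  embedding of fields sending \<open>a / b\<close> to the quotient of the series of \<open>a\<close> and \<open>b\<close>.
  It is the ordinary power series whenever the denominator does not vanish at 0
  (lemma \<open>ratfun_coeff_Fract\<close>).
\<close>

definition ratfun_expansion :: "ratfun \<Rightarrow> complex fls" where
  "ratfun_expansion F =
     (THE L. \<exists>a b. b \<noteq> 0 \<and> F = Fract a b \<and>
        L = fps_to_fls (fps_of_poly a) / fps_to_fls (fps_of_poly b))"

definition ratfun_coeff :: "ratfun \<Rightarrow> nat \<Rightarrow> complex" where
  "ratfun_coeff F x = fls_nth (ratfun_expansion F) (int x)"

lemma ratfun_expansion_Fract:
  assumes "b \<noteq> 0"
  shows "ratfun_expansion (Fract a b) = fps_to_fls (fps_of_poly a) / fps_to_fls (fps_of_poly b)"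
  unfolding ratfun_expansion_def
proof (rule the_equality)
  show "\<exists>c d. d \<noteq> 0 \<and> Fract a b = Fract c d \<and>
      fps_to_fls (fps_of_poly a) / fps_to_fls (fps_of_poly b)
        = fps_to_fls (fps_of_poly c) / fps_to_fls (fps_of_poly d)"
    using assms by blast
next
  fix L :: "complex fls"
  assume "\<exists>c d. d \<noteq> 0 \<and> Fract a b = Fract c d \<and>
      L = fps_to_fls (fps_of_poly c) / fps_to_fls (fps_of_poly d)"
  then obtain c d where d: "d \<noteq> 0" and "Fract a b = Fract c d"
    and L: "L = fps_to_fls (fps_of_poly c) / fps_to_fls (fps_of_poly d)"
    by blast
  then have eq: "c * b = a * d"
    using assms by (simp add: eq_fract)
  have "fps_to_fls (fps_of_poly c) * fps_to_fls (fps_of_poly b)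
      = fps_to_fls (fps_of_poly a) * fps_to_fls (fps_of_poly d)"
    by (simp flip: fps_of_poly_mult fls_times_fps_to_fls add: eq)
  with assms d show "L = fps_to_fls (fps_of_poly a) / fps_to_fls (fps_of_poly b)"
    by (simp add: L frac_eq_eq)
qed

lemma ratfun_coeff_Fract:
  assumes "poly b 0 \<noteq> 0"
  shows "ratfun_coeff (Fract a b) x = fps_nth (fps_of_poly a / fps_of_poly b) x"
proof -
  have b: "b \<noteq> 0" "fps_nth (fps_of_poly b) 0 \<noteq> 0"
    using assms by (auto simp: poly_0_coeff_0)
  have "subdegree (fps_of_poly b) = 0"
    using b by (simp add: subdegree_eq_0)
  then have "fps_to_fls (fps_of_poly a) / fps_to_fls (fps_of_poly b)
      = fps_to_fls (fps_of_poly a / fps_of_poly b)"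
    using b by (simp add: divide_inverse fps_divide_unit fls_times_fps_to_fls fls_inverse_fps_to_fls)
  then show ?thesis
    using b by (simp add: ratfun_coeff_def ratfun_expansion_Fract)
qed

section \<open>Cyclotomic polynomials and their logarithmic derivatives\<close>

definition cyclotomic :: "nat \<Rightarrow> complex poly" where
  "cyclotomic n = (\<Prod>k | 1 \<le> k \<and> k \<le> n \<and> gcd k n = 1.
     [:- exp (2 * of_real pi * \<i> * of_nat k / of_nat n), 1:])"

text \<open>
  \<open>d/dw [log f(w)]\<close> for a polynomial \<open>f\<close>, evaluated at a rational function \<open>w\<close>. This is the
  rational function \<open>f'(w) / f(w)\<close>; the lemma below confirms that it is the derivative of
  every local branch of \<open>log f\<close>.
\<close>

definition log_deriv :: "complex poly \<Rightarrow> ratfun \<Rightarrow> ratfun" where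
  "log_deriv f w = poly (map_poly ratfun_const (pderiv f)) w / poly (map_poly ratfun_const f) w"

lemma deriv_branch_of_log:
  fixes f :: "complex poly" and L :: "complex \<Rightarrow> complex"
  assumes "open U" "L holomorphic_on U" "\<And>w. w \<in> U \<Longrightarrow> exp (L w) = poly f w" "w \<in> U"
  shows "deriv L w = poly (pderiv f) w / poly f w"
proof -
  have L: "(L has_field_derivative deriv L w) (at w)"
    using assms holomorphic_derivI by blast
  have "((\<lambda>w. exp (L w)) has_field_derivative exp (L w) * deriv L w) (at w)"
    by (rule DERIV_chain2[OF DERIV_exp L])
  moreover have "((\<lambda>w. exp (L w)) has_field_derivative poly (pderiv f) w) (at w)"
    by (rule has_field_derivative_transform_within_open[OF poly_DERIV assms(1,4)])
       (simp add: assms(3))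
  ultimately have "exp (L w) * deriv L w = poly (pderiv f) w"
    by (rule DERIV_unique)
  then show ?thesis
    using assms(3,4) by (metis exp_not_eq_zero nonzero_mult_div_cancel_left)
qed

text \<open>
  The functions of \<open>q\<close> below take the rational function substituted for \<open>q\<close> as argument, so
  that \<open>Pi_fun n (- ratfun_q)\<close> is \<open>\<Pi>\<^sub>n(-q)\<close>.
\<close>

definition Phi_tilde :: "nat \<Rightarrow> ratfun \<Rightarrow> ratfun" where
  "Phi_tilde n q = 1 / q * log_deriv (cyclotomic n) (1 / q)"

text \<open>Meant for \<open>n \<ge> 2\<close> only; the natural number subtractions are then exact.\<close>

definition Pi_fun :: "nat \<Rightarrow> ratfun \<Rightarrow> ratfun" where
  "Pi_fun n q = (\<Sum>j=0..n-2. of_nat (n - 1 - j) * q ^ j * (1 - q) / (1 - q ^ n))"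

definition S0_tilde :: "nat \<Rightarrow> ratfun \<Rightarrow> ratfun" where
  "S0_tilde n q =
     (\<Sum>d | d dvd n \<and> d > 1 \<and> \<not> (\<exists>p k. prime p \<and> k \<ge> 1 \<and> (d = p ^ k \<or> d = 2 * p ^ k)).
        Phi_tilde d q)"

definition S1_tilde :: "nat \<Rightarrow> ratfun \<Rightarrow> ratfun" where
  "S1_tilde n q = (\<Sum>p | prime p \<and> p dvd n. Pi_fun (p ^ multiplicity p n) q)"

definition S2_tilde :: "nat \<Rightarrow> ratfun \<Rightarrow> ratfun" where
  "S2_tilde n q = (\<Sum>p | prime p \<and> 2 * p dvd n \<and> p > 2. Pi_fun (p ^ multiplicity p n) (- q))"

definition S_hat :: "(nat \<Rightarrow> ratfun \<Rightarrow> ratfun) \<Rightarrow> complex \<Rightarrow> nat \<Rightarrow> complex" where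
  "S_hat S \<alpha> x =
     ratfun_coeff (\<Sum>n=1..x. S n ratfun_q * ratfun_const (of_nat n powr (\<alpha> - 1))) x"

end

theory Submission
  imports Defs
begin

text \<open>
  Expanding the logarithmic derivative over the roots, the sum of \<open>\<Phi>~\<^sub>d(q)\<close> over all divisors
  \<open>d\<close> of \<open>n\<close> is the sum of \<open>1 / (1 - \<zeta> q)\<close> over all \<open>n\<close>-th roots of unity \<open>\<zeta>\<close>, which equals
  \<open>n / (1 - q\<^sup>n)\<close>; its coefficient at \<open>q\<^sup>x\<close> is \<open>n\<close> if \<open>n\<close> divides \<open>x\<close> and \<open>0\<close> otherwise. The divisor
  \<open>1\<close> contributes \<open>1 / (1 - q)\<close>, hence the harmonic number. The divisors \<open>p\<^sup>k\<close>, \<open>k \<ge> 1\<close>, contribute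
  \<open>N / (1 - q\<^sup>N) - 1 / (1 - q) = \<Pi>\<^sub>N(q)\<close> with \<open>N\<close> the exact power of \<open>p\<close> in \<open>n\<close>. For odd \<open>N\<close>,
  the difference of the sums for \<open>2N\<close> and \<open>N\<close> is \<open>N / (1 + q\<^sup>N)\<close>, so the divisors \<open>2p\<^sup>k\<close> contribute
  \<open>\<Pi>\<^sub>N(-q)\<close>.
\<close>

section \<open>Constants as rational functions and evaluation of polynomials at them\<close>

lemma ratfun_const_0 [simp]: "ratfun_const 0 = 0"
  by (simp add: ratfun_const_def)

lemma ratfun_const_1 [simp]: "ratfun_const 1 = 1"
  by (simp add: ratfun_const_def flip: one_pCons)

lemma ratfun_const_add: "ratfun_const (a + b) = ratfun_const a + ratfun_const b"
  by (simp add: ratfun_const_def flip: to_fract_add)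

lemma ratfun_const_uminus: "ratfun_const (- a) = - ratfun_const a"
  by (simp add: ratfun_const_def flip: to_fract_uminus)

lemma ratfun_const_mult: "ratfun_const (a * b) = ratfun_const a * ratfun_const b"
  by (simp add: ratfun_const_def flip: to_fract_mult)

lemma ratfun_const_power: "ratfun_const (a ^ n) = ratfun_const a ^ n"
  by (induction n) (auto simp: ratfun_const_mult)

lemma ratfun_const_sum: "ratfun_const (sum f A) = (\<Sum>i\<in>A. ratfun_const (f i))"
  by (induction A rule: infinite_finite_induct) (auto simp: ratfun_const_add)

lemma ratfun_const_of_nat: "ratfun_const (of_nat n) = of_nat n"
  by (induction n) (auto simp: ratfun_const_add)

text \<open>This Horner step drives the inductions below showing that substituting \<open>w\<close>
  is a ring homomorphism from complex polynomials to rational functions.\<close>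

lemma poly_map_ratfun_const_pCons:
  "poly (map_poly ratfun_const (pCons c p)) w
     = ratfun_const c + w * poly (map_poly ratfun_const p) w"
  by (simp add: map_poly_pCons)

lemma poly_map_ratfun_const_add:
  "poly (map_poly ratfun_const (p + r)) w
     = poly (map_poly ratfun_const p) w + poly (map_poly ratfun_const r) w"
  by (induction p r rule: poly_induct2)
     (auto simp: poly_map_ratfun_const_pCons ratfun_const_add algebra_simps)

lemma poly_map_ratfun_const_smult:
  "poly (map_poly ratfun_const (smult c p)) w
     = ratfun_const c * poly (map_poly ratfun_const p) w"
  by (induction p) (auto simp: poly_map_ratfun_const_pCons ratfun_const_mult algebra_simps)

lemma poly_map_ratfun_const_mult:
  "poly (map_poly ratfun_const (p * r)) w
     = poly (map_poly ratfun_const p) w * poly (map_poly ratfun_const r) w"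
  by (induction p)
     (auto simp: poly_map_ratfun_const_pCons poly_map_ratfun_const_add
       poly_map_ratfun_const_smult algebra_simps)

lemma poly_map_ratfun_const_1: "poly (map_poly ratfun_const 1) w = 1"
  by (simp add: one_pCons poly_map_ratfun_const_pCons)

section \<open>Logarithmic derivatives of products\<close>

lemma log_deriv_mult:
  assumes "poly (map_poly ratfun_const f) w \<noteq> 0" "poly (map_poly ratfun_const g) w \<noteq> 0"
  shows "log_deriv (f * g) w = log_deriv f w + log_deriv g w"
  using assms
  by (simp add: log_deriv_def pderiv_mult poly_map_ratfun_const_mult poly_map_ratfun_const_add
      field_simps)

text \<open>The product rule needs both factors to be nonzero at \<open>w\<close>, so nonvanishing
  of the product is carried through the same induction.\<close>

lemma log_deriv_prod_linear:
  assumes "finite A" "\<And>i. i \<in> A \<Longrightarrow> w \<noteq> ratfun_const (c i)"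
  shows "poly (map_poly ratfun_const (\<Prod>i\<in>A. [:- c i, 1:])) w \<noteq> 0 \<and>
         log_deriv (\<Prod>i\<in>A. [:- c i, 1:]) w = (\<Sum>i\<in>A. 1 / (w - ratfun_const (c i)))"
  using assms
proof (induction A rule: finite_induct)
  case empty
  show ?case
    by (simp add: log_deriv_def poly_map_ratfun_const_1)
next
  case (insert a A)
  have lin: "poly (map_poly ratfun_const [:- c a, 1:]) w = w - ratfun_const (c a)"
    by (simp add: poly_map_ratfun_const_pCons ratfun_const_uminus)
  have "log_deriv [:- c a, 1:] w = 1 / (w - ratfun_const (c a))"
    unfolding log_deriv_def lin by (simp add: pderiv_pCons poly_map_ratfun_const_pCons)
  moreover have "w - ratfun_const (c a) \<noteq> 0"
    using insert.prems by simp
  moreover have "poly (map_poly ratfun_const (\<Prod>i\<in>A. [:- c i, 1:])) w \<noteq> 0"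
    "log_deriv (\<Prod>i\<in>A. [:- c i, 1:]) w = (\<Sum>i\<in>A. 1 / (w - ratfun_const (c i)))"
    using insert by auto
  ultimately show ?case
    using insert.hyps lin by (simp add: log_deriv_mult poly_map_ratfun_const_mult del: mult_pCons_left)
qed

section \<open>Nonvanishing of the denominators\<close>

lemma ratfun_q_nonzero [simp]: "ratfun_q \<noteq> 0"
  by (simp add: ratfun_q_def)

lemma ratfun_q_power: "ratfun_q ^ n = to_fract (monom 1 n)"
proof (induction n)
  case (Suc n)
  have "monom (1 :: complex) (Suc n) = [:0, 1:] * monom 1 n"
    by (simp add: monom_Suc)
  then show ?case
    by (simp only: power_Suc Suc.IH to_fract_mult flip: ratfun_q_def)
qed simp

lemma one_minus_const_ratfun_q_power:
  "1 - ratfun_const c * ratfun_q ^ n = to_fract (1 - monom c n)"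
proof -
  have "monom c n = [:c:] * monom 1 n"
    by (simp add: smult_monom)
  then show ?thesis
    by (simp only: to_fract_diff to_fract_mult to_fract_1 ratfun_const_def ratfun_q_power)
qed

text \<open>The underlying polynomial has value 1 at 0. Taking \<open>c\<close> to be 1, -1 or a
  root of unity covers the denominators \<open>1 - q^n\<close>, \<open>1 + q^n\<close> and
  \<open>1 - zeta q\<close>.\<close>

lemma one_minus_const_ratfun_q_power_nonzero:
  assumes "n > 0"
  shows "1 - ratfun_const c * ratfun_q ^ n \<noteq> 0"
proof -
  have "poly (1 - monom c n) 0 \<noteq> 0"
    using assms by (simp add: poly_monom zero_power)
  then show ?thesis
    unfolding one_minus_const_ratfun_q_power by (metis poly_0 to_fract_eq_0_iff)
qed

lemma one_minus_const_ratfun_q_nonzero: "1 - ratfun_const c * ratfun_q \<noteq> 0"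
  using one_minus_const_ratfun_q_power_nonzero[of 1 c] by simp

section \<open>Roots of unity and the sum over all divisors\<close>

abbreviation root_unity :: "nat \<Rightarrow> nat \<Rightarrow> complex" where
  "root_unity n k \<equiv> exp (2 * of_real pi * \<i> * of_nat k / of_nat n)"

text \<open>At \<open>w = 1/q\<close> each root \<open>zeta\<close> contributes
  \<open>1 / (1/q - zeta)\<close>, and the prefactor \<open>1/q\<close> turns this into
  \<open>1 / (1 - zeta q)\<close>.\<close>

lemma Phi_tilde_eq_sum:
  "Phi_tilde d ratfun_q = (\<Sum>k | 1 \<le> k \<and> k \<le> d \<and> gcd k d = 1.
     1 / (1 - ratfun_const (root_unity d k) * ratfun_q))"
proof -
  let ?A = "{k. 1 \<le> k \<and> k \<le> d \<and> gcd k d = 1}"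
  have ne: "1 / ratfun_q \<noteq> ratfun_const c" for c
    using one_minus_const_ratfun_q_nonzero[of c] by (auto simp: field_simps)
  have "log_deriv (cyclotomic d) (1 / ratfun_q)
      = (\<Sum>k\<in>?A. 1 / (1 / ratfun_q - ratfun_const (root_unity d k)))"
    unfolding cyclotomic_def
    by (rule log_deriv_prod_linear[THEN conjunct2]) (use ne in auto)
  then have "Phi_tilde d ratfun_q
      = (\<Sum>k\<in>?A. 1 / ratfun_q * (1 / (1 / ratfun_q - ratfun_const (root_unity d k))))"
    by (simp only: Phi_tilde_def sum_distrib_left)
  also have "\<dots> = (\<Sum>k\<in>?A. 1 / (1 - ratfun_const (root_unity d k) * ratfun_q))"
    by (intro sum.cong refl) (simp add: field_simps)
  finally show ?thesis .
qed

text \<open>The assumption on \<open>f\<close> says that \<open>f d k\<close> depends only on the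
  fraction \<open>k/d\<close>. Each \<open>k/n\<close> has exactly one reduced form, whose
  denominator divides \<open>n\<close>. For roots of unity this collects the primitive ones of all
  orders dividing \<open>n\<close>.\<close>

lemma sum_reduced_fractions:
  fixes f :: "nat \<Rightarrow> nat \<Rightarrow> 'a :: comm_monoid_add"
  assumes n: "n > 0"
    and f: "\<And>d k m. d > 0 \<Longrightarrow> m > 0 \<Longrightarrow> f (m * d) (m * k) = f d k"
  shows "(\<Sum>d | d dvd n. \<Sum>k | 1 \<le> k \<and> k \<le> d \<and> gcd k d = 1. f d k) = (\<Sum>k=1..n. f n k)"
proof -
  have "(\<Sum>d | d dvd n. \<Sum>k | 1 \<le> k \<and> k \<le> d \<and> gcd k d = 1. f d k)
      = (\<Sum>(d, k)\<in>(SIGMA d:{d. d dvd n}. {k. 1 \<le> k \<and> k \<le> d \<and> gcd k d = 1}). f d k)"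
    using n by (intro sum.Sigma) auto
  also have "\<dots> = (\<Sum>k=1..n. f n k)"
  \<comment> \<open>The map \<open>j\<close> expands a reduced fraction to denominator
    \<open>n\<close>, and \<open>i\<close> cancels the gcd.\<close>
  proof (rule sum.reindex_bij_witness[where j = "\<lambda>(d, k). n div d * k"
        and i = "\<lambda>k. (n div gcd k n, k div gcd k n)"], goal_cases)
    case (1 a)
    then obtain d k m where a: "a = (d, k)" "n = d * m" "gcd k d = 1" by (auto elim: dvdE)
    then have "d > 0" "m > 0" using n by auto
    moreover have "gcd (m * k) (m * d) = m" using a by (simp add: gcd_mult_left)
    ultimately show ?case using a by (simp add: mult.commute)
  next
    case (2 a)
    then obtain d k m where a: "a = (d, k)" "n = d * m" "1 \<le> k" "k \<le> d" by (auto elim: dvdE)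
    then have "d > 0" "m > 0" using n by auto
    then show ?case using a by (simp add: mult.commute)
  next
    case (3 k)
    define g where "g = gcd k n"
    obtain m where m: "n = g * m"
      unfolding g_def by (meson dvdE gcd_dvd2)
    have "g dvd k"
      by (simp add: g_def)
    moreover have "n div (n div g) = g"
      using n unfolding m by simp
    ultimately show ?case
      by (simp flip: g_def)
  next
    case (4 k)
    define g a b where "g = gcd k n" and "a = k div g" and "b = n div g"
    have eqs: "k = g * a" "n = g * b"
      by (simp_all add: g_def a_def b_def)
    have "coprime a b"
      using n by (auto simp: a_def b_def g_def intro: div_gcd_coprime)
    with 4 n show ?case
      by (simp flip: g_def a_def b_def) (auto simp: eqs coprime_iff_gcd_eq_1)
  next
    case (5 a)
    then obtain d k m where a: "a = (d, k)" "n = d * m" "gcd k d = 1" by (auto elim: dvdE)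
    then have "d > 0" "m > 0" using n by auto
    then show ?case using a f[of d m k] by (simp add: mult.commute)
  qed
  finally show ?thesis .
qed

text \<open>The exponent is symmetric in \<open>j\<close> and \<open>k\<close>, so the sum is
  geometric with ratio \<open>u = root_unity n j\<close>. For \<open>0 < j < n\<close> it vanishes
  because \<open>u^n = 1\<close> but \<open>u\<close> is not 1.\<close>

lemma sum_root_unity_powers:
  assumes "n > 0" "j < n"
  shows "(\<Sum>k=1..n. root_unity n k ^ j) = (if j = 0 then of_nat n else 0)"
proof (cases "j = 0")
  case False
  define u where "u = root_unity n j"
  have "root_unity n k ^ j = u ^ k" for k
    unfolding u_def exp_of_nat_mult[symmetric] by (rule arg_cong[of _ _ exp]) simp
  then have "(\<Sum>k=1..n. root_unity n k ^ j) = (\<Sum>k=1..n. u ^ k)" by simp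
  also have "\<dots> = 0"
  proof -
    have "u \<noteq> 1" "u ^ n = 1"
      using assms False complex_root_unity_eq_1[of n j] complex_root_unity[of n j]
      by (auto simp: u_def dest: dvd_imp_le)
    moreover have "(1 - u) * (\<Sum>k=1..n. u ^ k) = u - u ^ Suc n"
      using sum_gp_multiplied[of 1 n u] assms by simp
    ultimately show ?thesis by simp
  qed
  finally show ?thesis using False by simp
qed simp

text \<open>Since \<open>y k ^ n = q^n\<close>, multiplying by \<open>1 - q^n\<close> turns each
  \<open>1 / (1 - y k)\<close> into a finite geometric sum. After exchanging the sums, the
  coefficient of \<open>q^j\<close> is a power sum of roots of unity, and only \<open>j = 0\<close>
  survives.\<close>

lemma sum_Phi_tilde_divisors:
  assumes n: "n > 0"
  shows "(\<Sum>d | d dvd n. Phi_tilde d ratfun_q) = of_nat n / (1 - ratfun_q ^ n)"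
proof -
  let ?q = "ratfun_q"
  define y where "y k = ratfun_const (root_unity n k) * ?q" for k
  have 1: "1 - ?q ^ n = (1 - y k) * (\<Sum>j<n. y k ^ j)" for k
  proof -
    have "y k ^ n = ?q ^ n"
      using complex_root_unity[of n k] n
      by (simp add: y_def power_mult_distrib flip: ratfun_const_power)
    then show ?thesis by (metis one_diff_power_eq)
  qed
  have "(\<Sum>d | d dvd n. Phi_tilde d ?q) = (\<Sum>k=1..n. 1 / (1 - y k))"
    unfolding Phi_tilde_eq_sum y_def
    by (rule sum_reduced_fractions[OF n]) (simp add: field_simps)
  also have "\<dots> * (1 - ?q ^ n) = (\<Sum>k=1..n. \<Sum>j<n. y k ^ j)"
    unfolding sum_distrib_right
  proof (intro sum.cong refl)
    fix k
    have "1 - y k \<noteq> 0"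
      unfolding y_def by (rule one_minus_const_ratfun_q_nonzero)
    then show "1 / (1 - y k) * (1 - ?q ^ n) = (\<Sum>j<n. y k ^ j)"
      by (subst 1[of k]) simp
  qed
  also have "\<dots> = (\<Sum>j<n. ratfun_const (\<Sum>k=1..n. root_unity n k ^ j) * ?q ^ j)"
    by (subst sum.swap)
       (simp only: y_def power_mult_distrib ratfun_const_sum ratfun_const_power sum_distrib_right)
  also have "\<dots> = (\<Sum>j<n. if j = 0 then of_nat n else 0)"
  proof (intro sum.cong refl)
    fix j assume "j \<in> {..<n}"
    then show "ratfun_const (\<Sum>k=1..n. root_unity n k ^ j) * ?q ^ j = (if j = 0 then of_nat n else 0)"
      by (subst sum_root_unity_powers) (auto simp: ratfun_const_of_nat)
  qed
  also have "\<dots> = of_nat n"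
    using n by simp
  finally show ?thesis
    using one_minus_const_ratfun_q_power_nonzero[OF n, of 1] by (simp add: eq_divide_eq)
qed

section \<open>Closed form of \<open>Pi_fun\<close>\<close>

text \<open>With \<open>N = m + 2\<close> this is the sum in the numerator of
  \<open>Pi_fun N q\<close>. Passing from \<open>m\<close> to \<open>m + 1\<close> raises every
  coefficient by one, which adds a full geometric sum.\<close>

lemma sum_arith_geometric:
  fixes q :: "'a :: comm_ring_1"
  shows "(1 - q) * (1 - q) * (\<Sum>j=0..m. of_nat (Suc m - j) * q ^ j)
    = of_nat (m + 2) * (1 - q) - (1 - q ^ (m + 2))"
proof (induction m)
  case 0
  show ?case by (simp add: algebra_simps power2_eq_square)
next
  case (Suc m)
  have "(\<Sum>j=0..Suc m. of_nat (Suc (Suc m) - j) * q ^ j)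
      = (\<Sum>j=0..Suc m. of_nat (Suc m - j) * q ^ j) + (\<Sum>j=0..Suc m. q ^ j)"
    unfolding sum.distrib[symmetric]
    by (intro sum.cong refl) (simp add: Suc_diff_le algebra_simps)
  \<comment> \<open>The top term has coefficient 0.\<close>
  also have "(\<Sum>j=0..Suc m. of_nat (Suc m - j) * q ^ j) = (\<Sum>j=0..m. of_nat (Suc m - j) * q ^ j)"
    by simp
  finally have "(1 - q) * (1 - q) * (\<Sum>j=0..Suc m. of_nat (Suc (Suc m) - j) * q ^ j)
      = of_nat (m + 2) * (1 - q) - (1 - q ^ (m + 2))
        + (1 - q) * ((1 - q) * (\<Sum>j=0..Suc m. q ^ j))"
    by (simp only: distrib_left Suc.IH mult.assoc[symmetric])
  also have "(1 - q) * (\<Sum>j=0..Suc m. q ^ j) = 1 - q ^ (m + 2)"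
    using sum_gp_multiplied[of 0 "Suc m" q] by simp
  finally show ?case by (simp add: algebra_simps)
qed

lemma Pi_fun_eq:
  assumes N: "N \<ge> 1" and "1 - q \<noteq> 0" "1 - q ^ N \<noteq> 0"
  shows "Pi_fun N q = of_nat N / (1 - q ^ N) - 1 / (1 - q)"
proof (cases "N = 1")
  \<comment> \<open>Truncated subtraction leaves only \<open>j = 0\<close> with coefficient 0, so
    \<open>Pi_fun 1 q = 0\<close>, in agreement with the formula. This case admits the exponent 0 in
    \<open>p ^ v\<close> below.\<close>
  case True
  then show ?thesis using assms by (simp add: Pi_fun_def)
next
  case False
  then obtain m where m: "N = m + 2"
    using N by (metis One_nat_def Suc_1 add.commute le_Suc_ex le_antisym not_less_eq_eq)
  have "Pi_fun N q = (1 - q) * (\<Sum>j=0..m. of_nat (Suc m - j) * q ^ j) / (1 - q ^ N)"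
    by (simp add: Pi_fun_def m sum_distrib_left sum_divide_distrib mult_ac)
  also have "\<dots> = (1 - q) * (1 - q) * (\<Sum>j=0..m. of_nat (Suc m - j) * q ^ j) / (1 - q ^ N) / (1 - q)"
    using assms by simp
  also have "\<dots> = (of_nat N * (1 - q) - (1 - q ^ N)) / (1 - q ^ N) / (1 - q)"
    by (simp only: sum_arith_geometric m)
  also have "\<dots> = of_nat N / (1 - q ^ N) - 1 / (1 - q)"
    using assms by (simp add: field_simps)
  finally show ?thesis .
qed

lemma Pi_fun_ratfun_q:
  assumes "N > 0"
  shows "Pi_fun N ratfun_q = of_nat N / (1 - ratfun_q ^ N) - 1 / (1 - ratfun_q)"
  using assms one_minus_const_ratfun_q_power_nonzero[of N 1] one_minus_const_ratfun_q_nonzero[of 1]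
  by (intro Pi_fun_eq) simp_all

text \<open>For odd \<open>N\<close> the sign leaves the power, \<open>(-q)^N = -(q^N)\<close>,
  which turns both denominators into sums.\<close>

lemma Pi_fun_uminus_ratfun_q:
  assumes "odd N"
  shows "Pi_fun N (- ratfun_q) = of_nat N / (1 + ratfun_q ^ N) - 1 / (1 + ratfun_q)"
proof -
  have N: "N > 0" "(- ratfun_q) ^ N = - (ratfun_q ^ N)"
    using assms by (auto intro: odd_pos)
  have "1 + ratfun_q ^ N \<noteq> 0" "1 + ratfun_q \<noteq> 0"
    using one_minus_const_ratfun_q_power_nonzero[OF N(1), of "-1"]
      one_minus_const_ratfun_q_nonzero[of "-1"]
    by (simp_all add: ratfun_const_uminus)
  then show ?thesis
    using Pi_fun_eq[of N "- ratfun_q"] N(1) unfolding N(2) diff_minus_eq_add by simp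
qed

section \<open>Contributions of the divisors \<open>p^k\<close> and \<open>2 p^k\<close>\<close>

lemma sum_divisors_prime_power:
  fixes f :: "nat \<Rightarrow> 'a :: comm_monoid_add"
  assumes "prime p"
  shows "(\<Sum>d | d dvd p ^ v. f d) = f 1 + (\<Sum>k=1..v. f (p ^ k))"
proof -
  have "{d. d dvd p ^ v} = (\<lambda>k. p ^ k) ` {0..v}"
    using divides_primepow_nat[OF assms] by auto
  moreover have "inj_on (\<lambda>k. p ^ k) {0..v}"
    using prime_gt_1_nat[OF assms] by (auto intro: inj_onI)
  ultimately have "(\<Sum>d | d dvd p ^ v. f d) = (\<Sum>k=0..v. f (p ^ k))"
    by (simp add: sum.reindex)
  then show ?thesis
    by (simp add: sum.atLeast_Suc_atMost)
qed

text \<open>The divisors of \<open>2 * N\<close> are split by parity: the odd ones divide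
  \<open>N\<close>, the even ones are doubles of divisors of \<open>N\<close>.\<close>

lemma sum_divisors_double:
  fixes f :: "nat \<Rightarrow> 'a :: comm_monoid_add"
  assumes "odd N"
  shows "(\<Sum>d | d dvd 2 * N. f d) = (\<Sum>d | d dvd N. f d) + (\<Sum>d | d dvd N. f (2 * d))"
proof -
  let ?D = "{d. d dvd N}"
  have "d dvd N" if "d dvd 2 * N" "odd d" for d
    using that by (metis coprime_commute coprime_dvd_mult_right_iff coprime_left_2_iff_odd)
  then have "d \<in> ?D \<union> (*) 2 ` ?D" if "d dvd 2 * N" for d
    using that by (cases "even d") (auto elim!: evenE)
  then have "{d. d dvd 2 * N} = ?D \<union> (*) 2 ` ?D"
    by auto
  moreover have "?D \<inter> (*) 2 ` ?D = {}"
    using assms by auto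
  moreover have "finite ?D"
    using assms by (intro finite_divisors_nat odd_pos)
  ultimately have "(\<Sum>d | d dvd 2 * N. f d) = sum f ?D + sum f ((*) 2 ` ?D)"
    by (simp add: sum.union_disjoint)
  also have "sum f ((*) 2 ` ?D) = (\<Sum>d | d dvd N. f (2 * d))"
    by (subst sum.reindex) (auto intro: inj_onI)
  finally show ?thesis .
qed

lemma Phi_tilde_1: "Phi_tilde 1 ratfun_q = 1 / (1 - ratfun_q)"
  using sum_Phi_tilde_divisors[of 1] by simp

lemma sum_Phi_tilde_prime_power:
  assumes "prime p"
  shows "(\<Sum>k=1..v. Phi_tilde (p ^ k) ratfun_q) = Pi_fun (p ^ v) ratfun_q"
proof -
  have "p ^ v > 0"
    using prime_gt_0_nat[OF assms] by simp
  have "of_nat (p ^ v) / (1 - ratfun_q ^ (p ^ v))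
      = Phi_tilde 1 ratfun_q + (\<Sum>k=1..v. Phi_tilde (p ^ k) ratfun_q)"
    unfolding sum_Phi_tilde_divisors[OF \<open>p ^ v > 0\<close>, symmetric]
    by (rule sum_divisors_prime_power[OF assms])
  then show ?thesis
    unfolding Pi_fun_ratfun_q[OF \<open>p ^ v > 0\<close>] Phi_tilde_1 by simp
qed

lemma sum_Phi_tilde_double_divisors:
  assumes "odd N"
  shows "(\<Sum>d | d dvd N. Phi_tilde (2 * d) ratfun_q) = of_nat N / (1 + ratfun_q ^ N)"
proof -
  have N: "N > 0" "2 * N > 0"
    using assms by (auto intro: odd_pos)
  define y where "y = ratfun_q ^ N"
  have "1 - y \<noteq> 0" "1 + y \<noteq> 0"
    using one_minus_const_ratfun_q_power_nonzero[OF N(1), of 1]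
      one_minus_const_ratfun_q_power_nonzero[OF N(1), of "-1"]
    by (simp_all add: y_def ratfun_const_uminus)
  moreover have "1 - ratfun_q ^ (2 * N) = (1 - y) * (1 + y)"
    by (simp add: y_def algebra_simps flip: power_add mult_2)
  \<comment> \<open>Partial fractions:
    \<open>2 / (1 - y^2) = 1 / (1 - y) + 1 / (1 + y)\<close>.\<close>
  ultimately have "of_nat (2 * N) / (1 - ratfun_q ^ (2 * N)) - of_nat N / (1 - y) = of_nat N / (1 + y)"
    by (simp add: divide_simps) (simp add: algebra_simps)
  moreover have "of_nat (2 * N) / (1 - ratfun_q ^ (2 * N))
      = of_nat N / (1 - y) + (\<Sum>d | d dvd N. Phi_tilde (2 * d) ratfun_q)"
    unfolding y_def sum_Phi_tilde_divisors[OF N(1), symmetric]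
      sum_Phi_tilde_divisors[OF N(2), symmetric]
    by (rule sum_divisors_double[OF assms])
  ultimately show ?thesis
    unfolding y_def by simp
qed

lemma sum_Phi_tilde_double_prime_power:
  assumes "prime p" "p > 2"
  shows "(\<Sum>k=1..v. Phi_tilde (2 * p ^ k) ratfun_q) = Pi_fun (p ^ v) (- ratfun_q)"
proof -
  have "odd (p ^ v)"
    using assms prime_odd_nat by simp
  have "of_nat (p ^ v) / (1 + ratfun_q ^ (p ^ v))
      = Phi_tilde (2 * 1) ratfun_q + (\<Sum>k=1..v. Phi_tilde (2 * p ^ k) ratfun_q)"
    unfolding sum_Phi_tilde_double_divisors[OF \<open>odd (p ^ v)\<close>, symmetric]
    by (rule sum_divisors_prime_power[OF assms(1)])
  \<comment> \<open>The divisor 2 is itself a prime power and is counted there; removing its term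
    \<open>1 / (1 + q)\<close> leaves exactly the exponents \<open>k \<ge> 1\<close>.\<close>
  moreover have "Phi_tilde (2 * 1) ratfun_q = 1 / (1 + ratfun_q)"
    using sum_Phi_tilde_double_divisors[of 1] by simp
  ultimately show ?thesis
    unfolding Pi_fun_uminus_ratfun_q[OF \<open>odd (p ^ v)\<close>] by simp
qed

section \<open>Classification of the divisors of \<open>n\<close>\<close>

text \<open>The classes are 1, the prime powers \<open>C\<close>, the doubled odd prime powers
  \<open>D\<close> and the remainder \<open>B\<close>. Unique factorization makes them disjoint and
  lets \<open>C\<close> and \<open>D\<close> be indexed by pairs of prime and exponent. The bound
  \<open>multiplicity p n\<close> encodes that \<open>p^k\<close> divides \<open>n\<close>.\<close>

lemma sum_divisors_partition:
  fixes f :: "nat \<Rightarrow> 'a :: comm_monoid_add"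
  assumes n: "n > 0"
  shows "(\<Sum>d | d dvd n. f d) = f 1
    + (\<Sum>d | d dvd n \<and> d > 1 \<and> \<not> (\<exists>p k. prime p \<and> k \<ge> 1 \<and> (d = p ^ k \<or> d = 2 * p ^ k)). f d)
    + (\<Sum>p | prime p \<and> p dvd n. \<Sum>k=1..multiplicity p n. f (p ^ k))
    + (\<Sum>p | prime p \<and> 2 * p dvd n \<and> p > 2. \<Sum>k=1..multiplicity p n. f (2 * p ^ k))"
proof -
  define B where "B = {d. d dvd n \<and> d > 1 \<and>
    \<not> (\<exists>p k. prime p \<and> k \<ge> 1 \<and> (d = p ^ k \<or> d = 2 * p ^ k))}"
  define P where "P = (SIGMA p:{p. prime p \<and> p dvd n}. {1..multiplicity p n})"
  define Q where "Q = (SIGMA p:{p. prime p \<and> 2 * p dvd n \<and> p > 2}. {1..multiplicity p n})"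
  define C where "C = (\<lambda>(p, k). p ^ k) ` P"
  define D where "D = (\<lambda>(p, k). 2 * p ^ k) ` Q"
  have dvd_iff: "p ^ k dvd n \<longleftrightarrow> k \<le> multiplicity p n" if "prime p" for p k
    by (rule power_dvd_iff_le_multiplicity) (use n that in auto)
  have fin: "finite {p. prime p \<and> p dvd n}" "finite {p. prime p \<and> 2 * p dvd n \<and> p > 2}"
    using n by (auto intro!: finite_subset[OF _ finite_divisors_nat[OF n]] dest: dvd_mult_right)
  have C: "d \<in> C \<longleftrightarrow> d dvd n \<and> (\<exists>p k. prime p \<and> k \<ge> 1 \<and> d = p ^ k)" for d
  proof
    assume "d \<in> C"
    then obtain p k where "prime p" "k \<ge> 1" "p ^ k dvd n" "d = p ^ k"
      by (auto simp: C_def P_def dvd_iff)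
    then show "d dvd n \<and> (\<exists>p k. prime p \<and> k \<ge> 1 \<and> d = p ^ k)"
      by blast
  next
    assume "d dvd n \<and> (\<exists>p k. prime p \<and> k \<ge> 1 \<and> d = p ^ k)"
    then obtain p k where pk: "d dvd n" "prime p" "k \<ge> 1" "d = p ^ k" by auto
    then have "p dvd n"
      by (auto intro: dvd_trans[OF dvd_power])
    then have "(p, k) \<in> P"
      using pk by (auto simp: P_def dvd_iff)
    then show "d \<in> C"
      using pk by (force simp: C_def)
  qed
  have D: "d \<in> D \<longleftrightarrow> d dvd n \<and> (\<exists>p k. prime p \<and> p > 2 \<and> k \<ge> 1 \<and> d = 2 * p ^ k)" for d
  proof
    assume "d \<in> D"
    then obtain p k where pk: "prime p" "2 * p dvd n" "p > 2" "k \<ge> 1" "p ^ k dvd n" "d = 2 * p ^ k"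
      by (auto simp: D_def Q_def dvd_iff)
    \<comment> \<open>Coprime divisors of \<open>n\<close> have a product dividing
      \<open>n\<close>.\<close>
    then have "coprime 2 (p ^ k)" "2 dvd n"
      by (auto simp: prime_odd_nat dest: dvd_mult_left)
    then show "d dvd n \<and> (\<exists>p k. prime p \<and> p > 2 \<and> k \<ge> 1 \<and> d = 2 * p ^ k)"
      using pk divides_mult by metis
  next
    assume "d dvd n \<and> (\<exists>p k. prime p \<and> p > 2 \<and> k \<ge> 1 \<and> d = 2 * p ^ k)"
    then obtain p k where pk: "d dvd n" "prime p" "p > 2" "k \<ge> 1" "d = 2 * p ^ k" by auto
    then have "2 * p dvd d" "p ^ k dvd n"
      by (auto intro: dvd_trans[of _ d] dvd_power)
    then have "(p, k) \<in> Q"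
      using pk by (auto simp: Q_def simp flip: dvd_iff intro: dvd_trans)
    then show "d \<in> D"
      using pk by (force simp: D_def)
  qed
  have "{d. d dvd n} = {1} \<union> (B \<union> (C \<union> D))"
  proof (intro set_eqI iffI)
    fix d assume "d \<in> {d. d dvd n}"
    then have d: "d dvd n" "d > 0" using n by (auto intro: Nat.gr0I)
    show "d \<in> {1} \<union> (B \<union> (C \<union> D))"
    proof (cases "d = 1 \<or> d \<in> B")
      case False
      then obtain p k where pk: "prime p" "k \<ge> 1" "d = p ^ k \<or> d = 2 * p ^ k"
        using d by (auto simp: B_def)
      \<comment> \<open>In the middle case \<open>d\<close> is a power of 2, hence already in
        \<open>C\<close>; only \<open>p > 2\<close> leads to \<open>D\<close>.\<close>
      consider "d = p ^ k" | "d = 2 * p ^ k" "p = 2" | "d = 2 * p ^ k" "p > 2"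
        using pk prime_ge_2_nat[of p] by linarith
      then show ?thesis
      proof cases
        case 2
        then have "d = 2 ^ Suc k" by simp
        then show ?thesis using d C[of d] two_is_prime_nat by (metis UnI1 UnI2 le_add1 plus_1_eq_Suc)
      qed (use pk d C D in blast)+
    qed auto
  qed (auto simp: B_def C D)
  moreover have "{1} \<inter> (B \<union> (C \<union> D)) = {}"
  proof -
    have "1 < p ^ k" if "prime p" "k \<ge> 1" for p k :: nat
      using that by (intro one_less_power prime_gt_1_nat) auto
    then have "1 \<notin> C"
      unfolding C by (metis less_irrefl)
    moreover have "1 \<notin> D"
      unfolding D by simp
    ultimately show ?thesis
      by (auto simp: B_def)
  qed
  moreover have "d \<notin> B" if "d \<in> C \<union> D" for d
    using that unfolding B_def Un_iff C D mem_Collect_eq by blast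
  then have "B \<inter> (C \<union> D) = {}"
    by blast
  moreover have "C \<inter> D = {}"
  proof -
    \<comment> \<open>Both 2 and \<open>r\<close> divide a power of \<open>p\<close>, so both equal
      \<open>p\<close>, contradicting \<open>r > 2\<close>.\<close>
    have False if "prime p" "prime r" "r > 2" "k \<ge> 1" "p ^ j = 2 * r ^ k" for p r j k :: nat
    proof -
      have "2 dvd p ^ j" "r dvd p ^ j"
        using that by (auto intro: dvd_power)
      then have "2 dvd p" "r dvd p"
        using that(2) two_is_prime_nat by (blast intro: prime_dvd_power)+
      then have "2 = p" "r = p"
        using that(1,2) two_is_prime_nat by (blast intro: primes_dvd_imp_eq)+
      with \<open>r > 2\<close> show False
        by simp
    qed
    then show ?thesis by (auto simp: C D)
  qed
  moreover have "finite {d. d dvd n}"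
    using n by simp
  ultimately have "(\<Sum>d | d dvd n. f d) = f 1 + (sum f B + (sum f C + sum f D))"
    by (simp only: finite_Un sum.union_disjoint) simp
  also have "sum f C = (\<Sum>(p, k)\<in>P. f (p ^ k))"
  proof -
    have "inj_on (\<lambda>(p, k). p ^ k) P"
    proof (rule inj_onI)
      fix x y
      assume *: "x \<in> P" "y \<in> P" "(\<lambda>(p, k). p ^ k) x = (\<lambda>(p, k). p ^ k) y"
      obtain p k r j where xy: "x = (p, k)" "y = (r, j)"
        by (metis surj_pair)
      \<comment> \<open>A positive exponent rules out the coincidence
        \<open>p^0 = r^0\<close>.\<close>
      have "prime p" "prime r" "k \<ge> 1"
        using * by (simp_all add: xy P_def)
      then show "x = y"
        using *(3) prime_power_inj''[of p r k j] by (simp add: xy)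
    qed
    then show ?thesis
      unfolding C_def by (subst sum.reindex) (auto simp: case_prod_unfold)
  qed
  also have "\<dots> = (\<Sum>p | prime p \<and> p dvd n. \<Sum>k=1..multiplicity p n. f (p ^ k))"
    unfolding P_def using fin by (intro sum.Sigma[symmetric]) auto
  also have "sum f D = (\<Sum>(p, k)\<in>Q. f (2 * p ^ k))"
  proof -
    have "inj_on (\<lambda>(p, k). 2 * p ^ k) Q"
    proof (rule inj_onI)
      fix x y
      assume *: "x \<in> Q" "y \<in> Q" "(\<lambda>(p, k). 2 * p ^ k) x = (\<lambda>(p, k). 2 * p ^ k) y"
      obtain p k r j where xy: "x = (p, k)" "y = (r, j)"
        by (metis surj_pair)
      have "prime p" "prime r" "k \<ge> 1"
        using * by (simp_all add: xy Q_def)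
      then show "x = y"
        using *(3) prime_power_inj''[of p r k j] by (simp add: xy)
    qed
    then show ?thesis
      unfolding D_def by (subst sum.reindex) (auto simp: case_prod_unfold)
  qed
  also have "\<dots> = (\<Sum>p | prime p \<and> 2 * p dvd n \<and> p > 2. \<Sum>k=1..multiplicity p n. f (2 * p ^ k))"
    unfolding Q_def using fin by (intro sum.Sigma[symmetric]) auto
  finally show ?thesis
    by (simp add: B_def add.assoc)
qed

text \<open>The summands on the left are the four divisor classes, the two prime-power classes being
  already summed to values of \<open>Pi_fun\<close>.\<close>

lemma S_tilde_sum:
  assumes "n > 0"
  shows "1 / (1 - ratfun_q) + S0_tilde n ratfun_q + S1_tilde n ratfun_q + S2_tilde n ratfun_q
    = of_nat n / (1 - ratfun_q ^ n)"
proof -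
  have "S1_tilde n ratfun_q
      = (\<Sum>p | prime p \<and> p dvd n. \<Sum>k=1..multiplicity p n. Phi_tilde (p ^ k) ratfun_q)"
    unfolding S1_tilde_def by (intro sum.cong refl) (simp only: mem_Collect_eq sum_Phi_tilde_prime_power)
  moreover have "S2_tilde n ratfun_q
      = (\<Sum>p | prime p \<and> 2 * p dvd n \<and> p > 2. \<Sum>k=1..multiplicity p n. Phi_tilde (2 * p ^ k) ratfun_q)"
    unfolding S2_tilde_def by (intro sum.cong refl) (simp only: mem_Collect_eq sum_Phi_tilde_double_prime_power)
  ultimately show ?thesis
    using sum_divisors_partition[OF assms, of "\<lambda>d. Phi_tilde d ratfun_q"]
    by (simp only: sum_Phi_tilde_divisors[OF assms] S0_tilde_def Phi_tilde_1)
qed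

section \<open>Coefficients of the expansion about 0\<close>

lemma ratfun_coeff_0: "ratfun_coeff 0 x = 0"
  using ratfun_coeff_Fract[of 1 0 x] by (simp add: Zero_fract_def)

text \<open>Laurent series form a field, so additivity holds for all rational functions.
  Coefficients can thus be distributed over the sums without checking that each summand is regular
  at 0.\<close>

lemma ratfun_coeff_add: "ratfun_coeff (F + G) x = ratfun_coeff F x + ratfun_coeff G x"
proof (cases F, cases G)
  fix a b c d :: "complex poly"
  assume eqs: "F = Fract a b" "b \<noteq> 0" "G = Fract c d" "d \<noteq> 0"
  have "ratfun_expansion (F + G) = ratfun_expansion F + ratfun_expansion G"
    using eqs
    by (simp add: ratfun_expansion_Fract fps_of_poly_add fps_of_poly_mult fls_times_fps_to_fls
        add_frac_eq)
  then show ?thesis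
    by (simp add: ratfun_coeff_def)
qed

lemma ratfun_coeff_sum: "ratfun_coeff (sum f A) x = (\<Sum>i\<in>A. ratfun_coeff (f i) x)"
  by (induction A rule: infinite_finite_induct) (simp_all add: ratfun_coeff_0 ratfun_coeff_add)

text \<open>The expansion is \<open>c\<close> times the sum of \<open>q^(m n)\<close> over
  \<open>m \<ge> 0\<close>. To verify it, this series \<open>G\<close> is multiplied by
  \<open>1 - X^n\<close>.\<close>

lemma ratfun_coeff_geometric:
  assumes n: "n > 0"
  shows "ratfun_coeff (ratfun_const c / (1 - ratfun_q ^ n)) x = (if n dvd x then c else 0)"
proof -
  define G where "G = Abs_fps (\<lambda>x. if n dvd x then c else 0)"
  have "G * (1 - fps_X ^ n) = fps_const c"
  proof (rule fps_ext)
    fix i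
    \<comment> \<open>Coefficients at \<open>i\<close> and \<open>i - n\<close> agree and cancel;
      below \<open>n\<close> only the index 0 is a multiple of \<open>n\<close>.\<close>
    have "n dvd i \<longleftrightarrow> n dvd (i - n)" if "i \<ge> n"
      using that by (metis dvd_add_triv_right_iff le_add_diff_inverse2)
    then show "(G * (1 - fps_X ^ n)) $ i = fps_const c $ i"
      using n by (auto simp: G_def right_diff_distrib fps_X_power_mult_right_nth dest: dvd_imp_le)
  qed
  then have G: "fps_const c / (1 - fps_X ^ n) = G"
  proof -
    have "(1 - fps_X ^ n) $ 0 = (1 :: complex)"
      using n by simp
    then have "1 - fps_X ^ n \<noteq> (0 :: complex fps)"
      by (metis fps_zero_nth zero_neq_one)
    then show ?thesis
      using \<open>G * (1 - fps_X ^ n) = fps_const c\<close> by (metis nonzero_mult_div_cancel_right)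
  qed
  have "ratfun_const c / (1 - ratfun_q ^ n) = Fract [:c:] (1 - monom 1 n)"
    using one_minus_const_ratfun_q_power[of 1 n] unfolding ratfun_const_1
    by (simp add: Fract_conv_to_fract ratfun_const_def del: to_fract_diff)
  moreover have "poly (1 - monom 1 n) (0 :: complex) \<noteq> 0"
    using n by (simp add: poly_monom zero_power)
  ultimately show ?thesis
    by (simp add: ratfun_coeff_Fract fps_of_poly_diff fps_of_poly_monom fps_of_poly_const G)
       (simp add: G_def)
qed

section \<open>Comparison of coefficients at \<open>q^x\<close>\<close>

theorem mainTheorem1:
  fixes \<alpha> :: complex and x :: nat
  assumes "x \<ge> 1"
  shows "divisor_sigma \<alpha> x = gen_harmonic (1 - \<alpha>) x
           + S_hat S0_tilde \<alpha> x + S_hat S1_tilde \<alpha> x + S_hat S2_tilde \<alpha> x"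
proof -
  let ?q = ratfun_q
  let ?c = "\<lambda>n. of_nat n powr (\<alpha> - 1)"
  let ?cr = "\<lambda>n. ratfun_const (?c n)"
  \<comment> \<open>All coefficients of \<open>1 / (1 - q)\<close> are 1, so the harmonic number is
    the weighted contribution of the divisor 1 of each \<open>n\<close>.\<close>
  have "gen_harmonic (1 - \<alpha>) x = ratfun_coeff (\<Sum>n=1..x. 1 / (1 - ?q) * ?cr n) x"
    using ratfun_coeff_geometric[of 1]
    by (simp add: gen_harmonic_def ratfun_coeff_sum)
  then have "gen_harmonic (1 - \<alpha>) x + S_hat S0_tilde \<alpha> x + S_hat S1_tilde \<alpha> x + S_hat S2_tilde \<alpha> x
      = ratfun_coeff (\<Sum>n=1..x. (1 / (1 - ?q) + S0_tilde n ?q + S1_tilde n ?q + S2_tilde n ?q) * ?cr n) x"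
    by (simp only: S_hat_def distrib_right sum.distrib ratfun_coeff_add)
  also have "\<dots> = (\<Sum>n=1..x. ratfun_coeff (ratfun_const (of_nat n * ?c n) / (1 - ?q ^ n)) x)"
    unfolding ratfun_coeff_sum
    by (intro sum.cong refl) (simp add: S_tilde_sum ratfun_const_mult ratfun_const_of_nat)
  also have "\<dots> = (\<Sum>n=1..x. if n dvd x then of_nat n * ?c n else 0)"
    by (intro sum.cong refl) (simp add: ratfun_coeff_geometric)
  \<comment> \<open>As \<open>x\<close> is positive, its divisors all lie between 1 and
    \<open>x\<close>; being nonzero, they also satisfy
    \<open>n * n powr (\<alpha> - 1) = n powr \<alpha>\<close>.\<close>
  also have "\<dots> = (\<Sum>n | n dvd x. of_nat n * ?c n)"
    using assms by (intro sum.mono_neutral_cong_right) (auto dest: dvd_imp_le intro: Nat.gr0I)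
  also have "\<dots> = divisor_sigma \<alpha> x"
    unfolding divisor_sigma_def
    using assms by (intro sum.cong refl) (auto simp: powr_diff)
  finally show ?thesis ..
qed

end
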